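(* Let $n\ge 1$. The maximal number of nonzero entries of an entrywise nonnegative matrix $\Delta\in\mathbb{R}^{n\times n}$ for which there exists $A\in\mathbb{R}^{n\times n}$ with $r(A,\Delta)=\infty$ is $\binom{n}{2}$. That is, whenever $A\in\mathbb{R}^{n\times n}$ and $\Delta\ge 0$ satisfy $r(A,\Delta)=\infty$, the matrix $\Delta$ has at most $\binom{n}{2}$ nonzero entries, and there are such $A$ and $\Delta$ for which $\Delta$ has exactly $\binom{n}{2}$ nonzero entries.
   Context: For $A\in\mathbb{R}^{n\times n}$ and an entrywise nonnegative $\Delta\in\mathbb{R}^{n\times n}$, the regularity radius is $r(A,\Delta)=\min\{\delta\ge 0 : [A-\delta\Delta,A+\delta\Delta]\text{ is singular}\}$, with value $\infty$ if no such $\delta$ exists. Here $[A-\delta\Delta,A+\delta\Delta]$ is the set of all real matrices $A'$ with $A-\delta\Delta\le A'\le A+\delta\Delta$ entrywise; it is called singular if it contains at least one singular matrix. *)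

theory Defs
  imports "HOL-Analysis.Analysis" "HOL-Library.Extended_Real"
begin

text \<open>
  Matrices are \<open>real ^ 'n ^ 'n\<close> with \<open>n = CARD('n) \<ge> 1\<close>. The order on this type is entrywise, so
  \<open>0 \<le> \<Delta>\<close> is entrywise nonnegativity and \<open>{L..U}\<close> is an interval matrix.
\<close>

definition singular_matrix_set :: "(real ^ 'n ^ 'n) set \<Rightarrow> bool" where
  "singular_matrix_set S \<longleftrightarrow> (\<exists>M\<in>S. \<not> invertible M)"

definition singular_at_radius :: "real ^ 'n ^ 'n \<Rightarrow> real ^ 'n ^ 'n \<Rightarrow> real \<Rightarrow> bool" where
  "singular_at_radius A \<Delta> \<delta> \<longleftrightarrow>
     0 \<le> \<delta> \<and> singular_matrix_set {A - \<delta> *\<^sub>R \<Delta> .. A + \<delta> *\<^sub>R \<Delta>}"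

text \<open>The minimum below is attained for \<open>0 \<le> \<Delta>\<close>, see \<open>regularity_radius_attained\<close>.\<close>

definition regularity_radius :: "real ^ 'n ^ 'n \<Rightarrow> real ^ 'n ^ 'n \<Rightarrow> ereal" where
  "regularity_radius A \<Delta> =
     (if \<exists>\<delta>. singular_at_radius A \<Delta> \<delta> then ereal (LEAST \<delta>. singular_at_radius A \<Delta> \<delta>) else \<infinity>)"

definition num_nonzero_entries :: "real ^ 'n ^ 'n \<Rightarrow> nat" where
  "num_nonzero_entries M = card {(i, j). M $ i $ j \<noteq> 0}"

lemma regularity_radius_attained:
  fixes A \<Delta> :: "real ^ 'n ^ 'n"
  assumes nonneg: "0 \<le> \<Delta>" and ex: "\<exists>\<delta>. singular_at_radius A \<Delta> \<delta>"
  obtains \<delta> where "regularity_radius A \<Delta> = ereal \<delta>" "singular_at_radius A \<Delta> \<delta>"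
    "\<And>\<epsilon>. singular_at_radius A \<Delta> \<epsilon> \<Longrightarrow> \<delta> \<le> \<epsilon>"
proof -
  obtain d where d: "singular_at_radius A \<Delta> d" using ex by blast
  define C where "C = {p :: real \<times> (real ^ 'n ^ 'n). det (snd p) = 0}
      \<inter> {p. \<forall>i j. A $ i $ j - fst p * \<Delta> $ i $ j \<le> snd p $ i $ j}
      \<inter> {p. \<forall>i j. snd p $ i $ j \<le> A $ i $ j + fst p * \<Delta> $ i $ j}"
  define K where "K = ({0..d} \<times> {A - d *\<^sub>R \<Delta> .. A + d *\<^sub>R \<Delta>}) \<inter> C"
  have "closed C"
    unfolding C_def det_def
    by (intro closed_Int closed_Collect_eq closed_Collect_all closed_Collect_le continuous_intros)
  then have "compact K"
    unfolding K_def by (intro compact_Int_closed compact_Times compact_interval) auto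
  then have cpt: "compact (fst ` K)"
    by (intro compact_continuous_image continuous_intros)
  have K_iff: "\<delta> \<in> fst ` K \<longleftrightarrow> singular_at_radius A \<Delta> \<delta> \<and> \<delta> \<le> d" for \<delta>
  proof
    assume "\<delta> \<in> fst ` K"
    then obtain M where M: "(\<delta>, M) \<in> K" by auto
    then have "M \<in> {A - \<delta> *\<^sub>R \<Delta> .. A + \<delta> *\<^sub>R \<Delta>}" "det M = 0" "0 \<le> \<delta>" "\<delta> \<le> d"
      by (simp_all add: K_def C_def less_eq_vec_def)
    then show "singular_at_radius A \<Delta> \<delta> \<and> \<delta> \<le> d"
      unfolding singular_at_radius_def singular_matrix_set_def using invertible_det_nz by blast
  next
    assume *: "singular_at_radius A \<Delta> \<delta> \<and> \<delta> \<le> d"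
    then obtain M where M: "M \<in> {A - \<delta> *\<^sub>R \<Delta> .. A + \<delta> *\<^sub>R \<Delta>}" "det M = 0"
      by (auto simp: singular_at_radius_def singular_matrix_set_def invertible_det_nz)
    have "\<delta> *\<^sub>R \<Delta> \<le> d *\<^sub>R \<Delta>"
      using * nonneg by (auto simp: less_eq_vec_def intro: mult_right_mono)
    then have "A - d *\<^sub>R \<Delta> \<le> A - \<delta> *\<^sub>R \<Delta>" "A + \<delta> *\<^sub>R \<Delta> \<le> A + d *\<^sub>R \<Delta>"
      by (simp_all add: less_eq_vec_def)
    then have "M \<in> {A - d *\<^sub>R \<Delta> .. A + d *\<^sub>R \<Delta>}"
      using M(1) by (meson atLeastAtMost_iff order_trans)
    then have "(\<delta>, M) \<in> K"
      using M * by (auto simp: K_def C_def singular_at_radius_def less_eq_vec_def)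
    then show "\<delta> \<in> fst ` K" by force
  qed
  have "fst ` K \<noteq> {}" using d K_iff by blast
  then obtain m where m: "m \<in> fst ` K" "\<forall>x \<in> fst ` K. m \<le> x"
    using compact_attains_inf[OF cpt] by blast
  have sing: "singular_at_radius A \<Delta> m" using m(1) K_iff by blast
  have least: "m \<le> \<epsilon>" if "singular_at_radius A \<Delta> \<epsilon>" for \<epsilon>
    using m K_iff that by (metis linear order_trans)
  have "(LEAST \<delta>. singular_at_radius A \<Delta> \<delta>) = m"
    using sing least by (rule Least_equality)
  then show thesis
    using that[of m] sing least ex by (simp add: regularity_radius_def)
qed

end

theory Submission
  imports Defs
begin

text \<open>
  Infinite radius means that \<open>A + M\<close> is invertible for every \<open>M\<close> supported on the support of
  \<open>\<Delta>\<close>. If \<open>N = A\<^sup>-\<^sup>1 M\<close> were symmetric and nonzero, it would have a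
  nonzero real eigenvalue \<open>c\<close>, and \<open>A - M / c = A (1 - N / c)\<close> would be singular. So the matrices
  \<open>A\<^sup>-\<^sup>1 M\<close> form a space that meets the symmetric matrices trivially, and its
  dimension is at most that of the skew-symmetric matrices. Equality is attained by the identity
  together with the strictly upper triangular 0/1 matrix.
\<close>

subsection \<open>Symmetric matrices\<close>

text \<open>The form \<open>c * (y \<bullet> y) - y \<bullet> (N *v y)\<close> is nonnegative and
  vanishes at \<open>x\<close>. Moving from \<open>x\<close> by \<open>t\<close> times the residual
  \<open>z\<close> changes it by \<open>t\<^sup>2 * a - 2 * t * (z \<bullet> z)\<close>, which is
  negative for small positive \<open>t\<close> unless \<open>z = 0\<close>.\<close>

lemma quadratic_form_max_eigenvector:
  fixes N :: "real^'n^'n"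
  assumes sym: "transpose N = N"
    and le: "\<And>y. y \<bullet> (N *v y) \<le> c * (y \<bullet> y)"
    and eq: "x \<bullet> (N *v x) = c * (x \<bullet> x)"
  shows "N *v x = c *\<^sub>R x"
proof -
  define z where "z = N *v x - c *\<^sub>R x"
  define a where "a = c * (z \<bullet> z) - z \<bullet> (N *v z)"
  have a: "a \<ge> 0" using le[of z] by (simp add: a_def)
  have swap: "x \<bullet> (N *v z) = z \<bullet> (N *v x)"
    by (metis dot_lmul_matrix inner_commute sym vector_transpose_matrix)
  have quad: "0 \<le> t\<^sup>2 * a - 2 * t * (z \<bullet> z)" for t
  proof -
    have form: "(x + t *\<^sub>R z) \<bullet> (N *v (x + t *\<^sub>R z)) =
        x \<bullet> (N *v x) + 2 * t * (z \<bullet> (N *v x)) + t\<^sup>2 * (z \<bullet> (N *v z))"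
      by (simp add: matrix_vector_right_distrib matrix_vector_mult_scaleR inner_add_left
          inner_add_right swap power2_eq_square algebra_simps)
    have norm: "(x + t *\<^sub>R z) \<bullet> (x + t *\<^sub>R z) = x \<bullet> x + 2 * t * (z \<bullet> x) + t\<^sup>2 * (z \<bullet> z)"
      by (simp add: inner_add_left inner_add_right power2_eq_square inner_commute)
    have "z \<bullet> z = z \<bullet> (N *v x) - c * (z \<bullet> x)"
      by (subst (2) z_def) (simp add: inner_diff_right)
    from arg_cong[OF this, of "\<lambda>u. 2 * t * u"] have "2 * t * (z \<bullet> z) = 2 * t * (z \<bullet> (N *v x)) - 2 * t * c * (z \<bullet> x)"
      by (simp add: algebra_simps)
    then show ?thesis
      using le[of "x + t *\<^sub>R z", unfolded form norm] eq by (simp add: a_def algebra_simps)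
  qed
  show ?thesis
  proof (cases "z \<bullet> z = 0")
    case True
    then show ?thesis by (simp add: z_def)
  next
    case False
    have "0 \<le> t * a - 2 * (z \<bullet> z)" if "t > 0" for t
    proof -
      have "0 \<le> t * (t * a - 2 * (z \<bullet> z))"
        using quad[of t] by (simp add: power2_eq_square algebra_simps)
      then show ?thesis using that by (simp add: zero_le_mult_iff)
    qed
    \<comment> \<open>This \<open>t\<close> makes \<open>t * a\<close> at most
      \<open>z \<bullet> z\<close>; the \<open>+ 1\<close> covers the case
      \<open>a = 0\<close>.\<close>
    from this[of "(z \<bullet> z) / (a + 1)"] have "2 * (z \<bullet> z) \<le> (z \<bullet> z) * (a / (a + 1))"
      using False a by (simp add: less_le)
    also have "\<dots> \<le> (z \<bullet> z) * 1"
      using a by (intro mult_left_mono) auto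
    finally have "z \<bullet> z \<le> 0" by simp
    then show ?thesis using False inner_ge_zero[of z] by linarith
  qed
qed

text \<open>The eigenvalue is the maximum of the quadratic form on the unit sphere, attained by
  compactness. Homogeneity extends the bound to all vectors, and the value at \<open>y\<close>
  forces the maximum to be positive.\<close>

lemma symmetric_positive_eigenvalue:
  fixes N :: "real^'n^'n"
  assumes sym: "transpose N = N" and pos: "0 < y \<bullet> (N *v y)"
  obtains c x where "c > 0" "x \<noteq> 0" "N *v x = c *\<^sub>R x"
proof -
  have "continuous_on (sphere 0 1) (\<lambda>x. x \<bullet> (N *v x))"
    by (intro continuous_on_inner continuous_on_id matrix_vector_mult_linear_continuous_on)
  moreover have "y \<noteq> 0" using pos by auto
  then have "y /\<^sub>R norm y \<in> sphere 0 1" by simp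
  ultimately obtain x where x: "x \<in> sphere 0 1"
    and max: "\<And>z. z \<in> sphere 0 1 \<Longrightarrow> z \<bullet> (N *v z) \<le> x \<bullet> (N *v x)"
    using continuous_attains_sup[OF compact_sphere, of 0 1 "\<lambda>x. x \<bullet> (N *v x)"] by auto
  define c where "c = x \<bullet> (N *v x)"
  have xx: "x \<bullet> x = 1" using x by (simp add: norm_eq_1)
  have le: "z \<bullet> (N *v z) \<le> c * (z \<bullet> z)" for z
  proof (cases "z = 0")
    case False
    then have "(z /\<^sub>R norm z) \<bullet> (N *v (z /\<^sub>R norm z)) \<le> c"
      unfolding c_def by (intro max) auto
    then have "(z \<bullet> (N *v z)) / (norm z)\<^sup>2 \<le> c"
      by (simp add: matrix_vector_mult_scaleR power2_eq_square field_simps)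
    then show ?thesis using False by (simp add: power2_norm_eq_inner pos_divide_le_eq)
  qed simp
  have "0 < c * (y \<bullet> y)" using le[of y] pos by linarith
  then have "c > 0" by (meson inner_ge_zero not_le zero_less_mult_iff)
  moreover have "x \<noteq> 0" using xx by auto
  moreover have "N *v x = c *\<^sub>R x"
    by (rule quadratic_form_max_eigenvector[OF sym le]) (simp add: c_def xx)
  ultimately show thesis by (rule that)
qed

text \<open>With \<open>c = 0\<close> every vector attains the maximum, hence lies in the
  kernel.\<close>

lemma symmetric_zero_quadratic_form:
  fixes N :: "real^'n^'n"
  assumes sym: "transpose N = N" and z: "\<And>y. y \<bullet> (N *v y) = 0"
  shows "N = 0"
proof -
  have "N *v x = 0" for x
    using quadratic_form_max_eigenvector[OF sym, of 0 x] z by simp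
  then show ?thesis by (simp add: matrix_eq)
qed

lemma symmetric_nonzero_eigenvalue:
  fixes N :: "real^'n^'n"
  assumes sym: "transpose N = N" and "N \<noteq> 0"
  obtains c x where "c \<noteq> 0" "x \<noteq> 0" "N *v x = c *\<^sub>R x"
proof -
  obtain y where y: "y \<bullet> (N *v y) \<noteq> 0"
    using symmetric_zero_quadratic_form assms by blast
  show thesis
  proof (cases "0 < y \<bullet> (N *v y)")
    case True
    then show thesis
      using symmetric_positive_eigenvalue[OF sym] that by (metis less_irrefl)
  next
    case False
    \<comment> \<open>A negative value of the form is a positive one for \<open>- N\<close>, whose
      eigenvalues are those of \<open>N\<close> negated.\<close>
    have neg: "(- N) *v x = - (N *v x)" for x
      by (metis diff_0 matrix_vector_mult_0 matrix_vector_mult_diff_rdistrib)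
    have "transpose (- N) = - N" using sym by (simp add: transpose_def vec_eq_iff)
    moreover have "0 < y \<bullet> ((- N) *v y)" using False y by (simp add: neg)
    ultimately obtain c x where "c > 0" "x \<noteq> 0" "(- N) *v x = c *\<^sub>R x"
      by (rule symmetric_positive_eigenvalue)
    then show thesis using that[of "- c" x] by (simp add: neg) (metis minus_minus)
  qed
qed

subsection \<open>Infinite regularity radius\<close>

definition supported_on :: "('n \<times> 'n) set \<Rightarrow> real^'n^'n \<Rightarrow> bool" where
  "supported_on S M \<longleftrightarrow> (\<forall>i j. M $ i $ j \<noteq> 0 \<longrightarrow> (i, j) \<in> S)"

text \<open>As \<delta> grows, the intervals exhaust the affine space of all \<open>A + M\<close>
  with \<open>M\<close> supported where \<Delta> is nonzero. This turns the radius into a question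
  of linear algebra.\<close>

lemma infinite_radius_iff:
  fixes A \<Delta> :: "real^'n^'n"
  assumes nonneg: "0 \<le> \<Delta>"
  shows "regularity_radius A \<Delta> = \<infinity> \<longleftrightarrow>
    (\<forall>M. supported_on {(i, j). \<Delta> $ i $ j \<noteq> 0} M \<longrightarrow> invertible (A + M))"
proof
  assume inf: "regularity_radius A \<Delta> = \<infinity>"
  show "\<forall>M. supported_on {(i, j). \<Delta> $ i $ j \<noteq> 0} M \<longrightarrow> invertible (A + M)"
  proof (intro allI impI)
    fix M assume supp: "supported_on {(i, j). \<Delta> $ i $ j \<noteq> 0} M"
    \<comment> \<open>The sum dominates each single ratio. Where \<Delta> vanishes the quotient is 0
      by convention, and there \<open>M\<close> vanishes too.\<close>
    define \<delta> where "\<delta> = (\<Sum>p\<in>UNIV. \<bar>M $ fst p $ snd p\<bar> / \<Delta> $ fst p $ snd p)"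
    have D: "0 \<le> \<Delta> $ i $ j" for i j using nonneg by (simp add: less_eq_vec_def)
    have \<delta>: "\<delta> \<ge> 0" unfolding \<delta>_def using D by (intro sum_nonneg) auto
    have bd: "\<bar>M $ i $ j\<bar> \<le> \<delta> * \<Delta> $ i $ j" for i j
    proof (cases "M $ i $ j = 0")
      case True
      then show ?thesis using \<delta> D by simp
    next
      case False
      then have pos: "\<Delta> $ i $ j > 0" using supp D[of i j] by (auto simp: supported_on_def less_le)
      have "\<bar>M $ i $ j\<bar> / \<Delta> $ i $ j \<le> \<delta>"
        unfolding \<delta>_def
        using member_le_sum[of "(i, j)" UNIV "\<lambda>p. \<bar>M $ fst p $ snd p\<bar> / \<Delta> $ fst p $ snd p"] D by auto
      then show ?thesis using pos by (simp add: pos_divide_le_eq)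
    qed
    have "A + M \<in> {A - \<delta> *\<^sub>R \<Delta> .. A + \<delta> *\<^sub>R \<Delta>}"
      using bd by (auto simp: less_eq_vec_def abs_le_iff) (metis add.inverse_inverse neg_le_iff_le)
    moreover have "\<not> singular_at_radius A \<Delta> \<delta>"
      using inf by (auto simp: regularity_radius_def split: if_splits)
    ultimately show "invertible (A + M)"
      using \<delta> by (auto simp: singular_at_radius_def singular_matrix_set_def)
  qed
next
  assume inv: "\<forall>M. supported_on {(i, j). \<Delta> $ i $ j \<noteq> 0} M \<longrightarrow> invertible (A + M)"
  have "invertible B" if B: "B \<in> {A - \<delta> *\<^sub>R \<Delta> .. A + \<delta> *\<^sub>R \<Delta>}" for B \<delta>
  proof -
    have "supported_on {(i, j). \<Delta> $ i $ j \<noteq> 0} (B - A)"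
      unfolding supported_on_def
    proof (intro allI impI)
      fix i j assume "(B - A) $ i $ j \<noteq> 0"
      \<comment> \<open>If the entry of \<Delta> were 0, the two bounds would force \<open>B\<close>
        to agree with \<open>A\<close> there.\<close>
      moreover have "A $ i $ j - \<delta> * \<Delta> $ i $ j \<le> B $ i $ j" "B $ i $ j \<le> A $ i $ j + \<delta> * \<Delta> $ i $ j"
        using B by (simp_all add: less_eq_vec_def)
      ultimately show "(i, j) \<in> {(i, j). \<Delta> $ i $ j \<noteq> 0}" by auto
    qed
    then show ?thesis using inv by (metis add.commute diff_add_cancel)
  qed
  then show "regularity_radius A \<Delta> = \<infinity>"
    by (auto simp: regularity_radius_def singular_at_radius_def singular_matrix_set_def)
qed

text \<open>An eigenpair of \<open>A' ** M\<close> with \<open>c \<noteq> 0\<close> gives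
  \<open>M *v x = c *\<^sub>R (A *v x)\<close>, so the member of the line at
  \<open>t = - (1 / c)\<close> has \<open>x\<close> in its kernel.\<close>

lemma not_symmetric_if_affine_invertible:
  fixes A A' M :: "real^'n^'n"
  assumes inv: "\<And>t. invertible (A + t *\<^sub>R M)" and A': "A ** A' = mat 1"
    and sym: "transpose (A' ** M) = A' ** M"
  shows "M = 0"
proof (rule ccontr)
  assume "M \<noteq> 0"
  have AM: "A ** (A' ** M) = M" by (simp add: A' matrix_mul_assoc)
  moreover have "A ** (0 :: real^'n^'n) = 0" by (simp add: matrix_matrix_mult_def vec_eq_iff)
  ultimately have "A' ** M \<noteq> 0" using \<open>M \<noteq> 0\<close> by metis
  then obtain c x where c: "c \<noteq> 0" and x: "x \<noteq> 0" and ev: "(A' ** M) *v x = c *\<^sub>R x"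
    using symmetric_nonzero_eigenvalue[OF sym] by blast
  have "M *v x = c *\<^sub>R (A *v x)"
    by (metis AM ev matrix_vector_mul_assoc matrix_vector_mult_scaleR)
  then have "(A - (1 / c) *\<^sub>R M) *v x = 0"
    using c by (simp add: matrix_vector_mult_diff_rdistrib flip: scaleR_matrix_vector_assoc)
  then show False
    using inv[of "- (1 / c)"] x by simp (metis invertible_def matrix_left_invertible_ker)
qed

subsection \<open>Counting entries\<close>

text \<open>The standard basis matrices at the positions in \<open>S\<close>; they turn the count of
  positions into a dimension.\<close>

definition matrix_units :: "('n \<times> 'n) set \<Rightarrow> (real^'n^'n) set" where
  "matrix_units S = (\<lambda>(i, j). axis i (axis j 1)) ` S"

lemma inj_matrix_unit: "inj (\<lambda>(i :: 'n, j :: 'n). axis i (axis j 1) :: real^'n^'n)"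
  by (auto simp: inj_on_def axis_eq_axis)

lemma card_matrix_units: "card (matrix_units S) = card S"
  unfolding matrix_units_def by (rule card_image[OF inj_on_subset[OF inj_matrix_unit subset_UNIV]])

lemma dim_matrix_units: "dim (matrix_units S) = card S"
proof -
  have "matrix_units S \<subseteq> Basis"
    by (auto simp: matrix_units_def Basis_vec_def)
  then have "independent (matrix_units S)"
    using independent_Basis independent_mono by blast
  then show ?thesis by (simp add: dim_eq_card_independent card_matrix_units)
qed

lemma span_matrix_units:
  fixes S :: "('n::finite \<times> 'n) set"
  shows "span (matrix_units S) = {M. supported_on S M}"
proof
  have "subspace {M. supported_on S M}"
    by (auto simp: subspace_def supported_on_def) force
  moreover have "matrix_units S \<subseteq> {M. supported_on S M}"
    by (auto simp: matrix_units_def supported_on_def axis_def split: if_splits)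
  ultimately show "span (matrix_units S) \<subseteq> {M. supported_on S M}"
    by (simp add: span_minimal)
next
  show "{M. supported_on S M} \<subseteq> span (matrix_units S)"
  proof
    fix M :: "real^'n^'n" assume "M \<in> {M. supported_on S M}"
    then have M: "M $ i $ j = 0" if "(i, j) \<notin> S" for i j
      using that by (auto simp: supported_on_def)
    have "M = (\<Sum>(i, j)\<in>S. M $ i $ j *\<^sub>R axis i (axis j 1))"
    proof -
      have "(\<Sum>(i, j)\<in>S. M $ i $ j *\<^sub>R axis i (axis j 1)) $ k $ l = M $ k $ l" for k l
      proof -
        have "(\<Sum>(i, j)\<in>S. M $ i $ j *\<^sub>R axis i (axis j 1)) $ k $ l =
            (\<Sum>p\<in>S. if p = (k, l) then M $ k $ l else 0)"
          unfolding sum_component by (intro sum.cong) (auto simp: axis_def split: if_splits)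
        then show ?thesis using M by simp
      qed
      then show ?thesis by (simp add: vec_eq_iff)
    qed
    also have "\<dots> \<in> span (matrix_units S)"
      by (intro span_sum) (force simp: matrix_units_def intro!: span_mul[OF span_base])
    finally show "M \<in> span (matrix_units S)" .
  qed
qed

text \<open>Each two-element set arises from exactly one ordering of its elements that increases
  \<open>f\<close>.\<close>

lemma card_increasing_pairs:
  fixes f :: "'a::finite \<Rightarrow> nat"
  assumes "inj f"
  shows "card {(i, j). f i < f j} = CARD('a) choose 2"
proof -
  have "bij_betw (\<lambda>(i, j). {i, j}) {(i, j). f i < f j} {B. B \<subseteq> UNIV \<and> card B = 2}"
    unfolding bij_betw_def
  proof
    show "inj_on (\<lambda>(i, j). {i, j}) {(i, j). f i < f j}"
      by (auto simp: inj_on_def doubleton_eq_iff)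
    show "(\<lambda>(i, j). {i, j}) ` {(i, j). f i < f j} = {B. B \<subseteq> UNIV \<and> card B = 2}"
    proof (intro equalityI subsetI)
      fix B :: "'a set" assume "B \<in> {B. B \<subseteq> UNIV \<and> card B = 2}"
      then obtain i j where B: "B = {i, j}" "i \<noteq> j" by (auto simp: card_2_iff)
      then have "f i < f j \<or> f j < f i" using assms by (metis injD linorder_neqE_nat)
      then show "B \<in> (\<lambda>(i, j). {i, j}) ` {(i, j). f i < f j}"
        using B by (force simp: insert_commute)
    qed (auto simp: card_insert_if)
  qed
  then show ?thesis using n_subsets[of "UNIV :: 'a set" 2] by (simp add: bij_betw_same_card)
qed

text \<open>The index type carries no order; such an \<open>f\<close> supplies one, so that "above
  the diagonal" makes sense.\<close>

lemma inj_to_nat: obtains f :: "'n::finite \<Rightarrow> nat" where "inj f"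
  using finite_imp_inj_to_nat_seg[of "UNIV :: 'n set"] by auto

text \<open>The skew part of \<open>A' ** M\<close> depends linearly on \<open>M\<close> and
  vanishes only if \<open>A' ** M\<close> is symmetric, hence only for \<open>M = 0\<close>. So the
  space supported on \<open>S\<close> embeds into the strictly upper triangular matrices.\<close>

lemma card_support_le:
  fixes A :: "real^'n^'n" and S :: "('n::finite \<times> 'n) set"
  assumes inv: "\<And>M. supported_on S M \<Longrightarrow> invertible (A + M)"
  shows "card S \<le> CARD('n) choose 2"
proof -
  obtain f :: "'n \<Rightarrow> nat" where f: "inj f" by (rule inj_to_nat)
  have "invertible A" using inv[of 0] by (simp add: supported_on_def)
  then obtain A' where A': "A ** A' = mat 1" unfolding invertible_def by blast
  \<comment> \<open>the entries of the skew part of \<open>A' ** M\<close> above the diagonal, which determine it\<close>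
  define \<phi> :: "real^'n^'n \<Rightarrow> real^'n^'n" where
    "\<phi> M = (\<chi> i j. if f i < f j then (A' ** M) $ i $ j - (A' ** M) $ j $ i else 0)" for M
  have lin: "linear \<phi>"
    by (rule linearI)
      (auto simp: \<phi>_def vec_eq_iff matrix_matrix_mult_def sum.distrib sum_distrib_left algebra_simps)
  have inj: "inj_on \<phi> (span (matrix_units S))"
    unfolding linear_injective_on_subspace_0[OF lin subspace_span]
  proof (intro ballI impI)
    fix M assume "M \<in> span (matrix_units S)" and 0: "\<phi> M = 0"
    then have supp: "supported_on S M" by (simp add: span_matrix_units)
    have upper: "(A' ** M) $ i $ j = (A' ** M) $ j $ i" if "f i < f j" for i j
    proof -
      have "\<phi> M $ i $ j = 0" by (simp add: 0)
      then show ?thesis using that by (simp add: \<phi>_def)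
    qed
    then have "(A' ** M) $ i $ j = (A' ** M) $ j $ i" for i j
      using f by (metis injD linorder_neqE_nat)
    then have "transpose (A' ** M) = A' ** M" by (simp add: transpose_def vec_eq_iff)
    moreover have "invertible (A + t *\<^sub>R M)" for t
      using supp by (intro inv) (simp add: supported_on_def)
    ultimately show "M = 0" using A' not_symmetric_if_affine_invertible by blast
  qed
  \<comment> \<open>Injectivity on the span preserves the dimension, so the images of the matrix
    units suffice.\<close>
  have "card S = dim (\<phi> ` matrix_units S)"
    by (simp add: dim_image_eq[OF lin inj] dim_matrix_units)
  also have "\<dots> \<le> dim (matrix_units {(i, j). f i < f j})"
    by (rule dim_mono) (auto simp: span_matrix_units supported_on_def \<phi>_def split: if_splits)
  also have "\<dots> = CARD('n) choose 2"
    using f by (simp add: dim_matrix_units card_increasing_pairs)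
  finally show ?thesis .
qed

text \<open>Back substitution: for a kernel vector \<open>x\<close>, take the nonzero coordinate
  \<open>i\<close> with the largest \<open>f i\<close>. Row \<open>i\<close> of \<open>M\<close>
  meets only coordinates with larger \<open>f\<close>, all zero, so row \<open>i\<close> of the
  equation reads \<open>x $ i = 0\<close>.\<close>

lemma invertible_unitriangular:
  fixes f :: "'n::finite \<Rightarrow> nat" and M :: "real^'n^'n"
  assumes f: "inj f" and supp: "supported_on {(i, j). f i < f j} M"
  shows "invertible (mat 1 + M)"
proof -
  have "x = 0" if Mx: "(mat 1 + M) *v x = 0" for x
  proof (rule ccontr)
    assume "x \<noteq> 0"
    then have "Max (f ` {k. x $ k \<noteq> 0}) \<in> f ` {k. x $ k \<noteq> 0}"
      by (intro Max_in) (auto simp: vec_eq_iff)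
    then obtain i where i: "x $ i \<noteq> 0" and "f i = Max (f ` {k. x $ k \<noteq> 0})" by auto
    then have max: "f j \<le> f i" if "x $ j \<noteq> 0" for j using that by simp
    have "M $ i $ j * x $ j = 0" for j
      using supp max[of j] by (fastforce simp: supported_on_def)
    then have "(M *v x) $ i = 0" by (simp add: matrix_vector_mult_def sum.neutral)
    then show False
      using Mx i by (metis add.right_neutral matrix_vector_mul_lid matrix_vector_mult_add_rdistrib
          vector_add_component zero_index)
  qed
  then show ?thesis
    using matrix_left_invertible_ker invertible_left_inverse by blast
qed

theorem proposition3p4:
  shows "(\<forall>A \<Delta> :: real ^ 'n ^ 'n. 0 \<le> \<Delta> \<and> regularity_radius A \<Delta> = \<infinity> \<longrightarrow>
            num_nonzero_entries \<Delta> \<le> CARD('n) choose 2) \<and>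
         (\<exists>A \<Delta> :: real ^ 'n ^ 'n. 0 \<le> \<Delta> \<and> regularity_radius A \<Delta> = \<infinity> \<and>
            num_nonzero_entries \<Delta> = CARD('n) choose 2)"
proof
  \<comment> \<open>The bound is applied with \<open>S\<close> the set of nonzero positions of
    \<Delta>.\<close>
  show "\<forall>A \<Delta> :: real ^ 'n ^ 'n. 0 \<le> \<Delta> \<and> regularity_radius A \<Delta> = \<infinity> \<longrightarrow>
            num_nonzero_entries \<Delta> \<le> CARD('n) choose 2"
    unfolding num_nonzero_entries_def using infinite_radius_iff card_support_le by blast
next
  obtain f :: "'n \<Rightarrow> nat" where f: "inj f" by (rule inj_to_nat)
  define \<Delta> :: "real^'n^'n" where "\<Delta> = (\<chi> i j. if f i < f j then 1 else 0)"
  have supp: "{(i, j). \<Delta> $ i $ j \<noteq> 0} = {(i, j). f i < f j}"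
    by (auto simp: \<Delta>_def)
  have nonneg: "0 \<le> \<Delta>" by (simp add: \<Delta>_def less_eq_vec_def)
  \<comment> \<open>Every perturbation of the identity supported where \<Delta> is nonzero is
    unitriangular in the order given by \<open>f\<close>.\<close>
  have "regularity_radius (mat 1) \<Delta> = \<infinity>"
    using f by (simp add: infinite_radius_iff[OF nonneg] supp invertible_unitriangular)
  moreover have "num_nonzero_entries \<Delta> = CARD('n) choose 2"
    using f by (simp add: num_nonzero_entries_def supp card_increasing_pairs)
  ultimately show "\<exists>A \<Delta> :: real ^ 'n ^ 'n. 0 \<le> \<Delta> \<and> regularity_radius A \<Delta> = \<infinity> \<and>
            num_nonzero_entries \<Delta> = CARD('n) choose 2"
    using nonneg by blast
qed

end
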